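(* Let $\lambda \ge 0$ and $a_\lambda \ge 0$ be prespecified constants such that $\mathbb{P}(M_\lambda \le a_\lambda \mid \mathbf{x}) > 0$. If $N_T = N_C$, then $$\mathbb{E}[\bar{\mathbf{x}}_T - \bar{\mathbf{x}}_C \mid \mathbf{x}, M_\lambda \le a_\lambda] = 0 \qquad\text{and}\qquad \mathbb{E}[\hat\tau \mid \mathbf{x}, M_\lambda \le a_\lambda] = \tau .$$
   Context: There are $N$ units, with $N_T \geq 1$ to be treated and $N_C = N - N_T \geq 1$ to be control. $\mathbf{x}$ is a fixed real $N\times K$ covariate matrix, and each unit $i$ has fixed real potential outcomes $Y_i(1), Y_i(0)$. The only randomness is the assignment vector $\mathbf{W}=(W_1,\dots,W_N)^\top \in \{0,1\}^N$, uniformly distributed over the vectors with exactly $N_T$ entries equal to $1$ (completely randomized experiment); conditioning on $\mathbf{x}$ just means that $\mathbf{x}$ is fixed. $\bar{\mathbf{x}}_T = N_T^{-1}\mathbf{x}^\top \mathbf{W}$ and $\bar{\mathbf{x}}_C = N_C^{-1}\mathbf{x}^\top(\mathbf{1}_N-\mathbf{W})$, where $\mathbf{1}_N$ is the all-ones column vector. $\mathbf{\Sigma} = \mathrm{Cov}(\bar{\mathbf{x}}_T-\bar{\mathbf{x}}_C\mid\mathbf{x}) = \frac{N}{N_T N_C} S^2_{\mathbf{x}}$, where $S^2_{\mathbf{x}} = (N-1)^{-1}(\mathbf{x}-\mathbf{1}_N\bar{\mathbf{x}}_N)^\top(\mathbf{x}-\mathbf{1}_N\bar{\mathbf{x}}_N)$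 and $\bar{\mathbf{x}}_N = N^{-1}\mathbf{1}_N^\top\mathbf{x}$. It is assumed that $\mathbf{\Sigma}$ is positive definite. The ridge Mahalanobis distance is $M_\lambda = (\bar{\mathbf{x}}_T-\bar{\mathbf{x}}_C)^\top(\mathbf{\Sigma}+\lambda \mathbf{I}_K)^{-1}(\bar{\mathbf{x}}_T-\bar{\mathbf{x}}_C)$. The observed outcomes are $y_i^{obs} = W_iY_i(1)+(1-W_i)Y_i(0)$; $\tau = \frac1N\sum_{i=1}^N [Y_i(1)-Y_i(0)]$; $\hat\tau = N_T^{-1}\sum_i W_i y_i^{obs} - N_C^{-1}\sum_i (1-W_i) y_i^{obs}$. *)

theory Defs
  imports "HOL-Probability.Probability"
begin

text \<open>
  The units are the elements of the finite type \<open>'n\<close> and the covariates are indexed by the finite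
  type \<open>'k\<close>, so the \<open>N \<times> K\<close> covariate matrix has type \<open>real ^ 'k ^ 'n\<close>, with \<open>x $ i\<close> the row of unit
  \<open>i\<close>. The vector \<open>1 :: real ^ 'n\<close> is the all-ones vector. The parameters \<open>nT\<close>, \<open>nC\<close> are meant to
  satisfy \<open>nT \<ge> 1\<close>, \<open>nC \<ge> 1\<close> and \<open>nT + nC = CARD('n)\<close>.
\<close>

definition assignments :: "nat \<Rightarrow> (real ^ 'n) set" where
  "assignments nT = {W. (\<forall>i. W $ i \<in> {0, 1}) \<and> card {i. W $ i = 1} = nT}"

definition design :: "nat \<Rightarrow> (real ^ 'n) pmf" where
  "design nT = pmf_of_set (assignments nT)"

definition xbar_T :: "nat \<Rightarrow> real ^ 'k ^ 'n \<Rightarrow> real ^ 'n \<Rightarrow> real ^ 'k" where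
  "xbar_T nT x W = (1 / real nT) *\<^sub>R (transpose x *v W)"

definition xbar_C :: "nat \<Rightarrow> real ^ 'k ^ 'n \<Rightarrow> real ^ 'n \<Rightarrow> real ^ 'k" where
  "xbar_C nC x W = (1 / real nC) *\<^sub>R (transpose x *v (1 - W))"

definition xdiff :: "nat \<Rightarrow> nat \<Rightarrow> real ^ 'k ^ 'n \<Rightarrow> real ^ 'n \<Rightarrow> real ^ 'k" where
  "xdiff nT nC x W = xbar_T nT x W - xbar_C nC x W"

definition cov_matrix :: "'a pmf \<Rightarrow> ('a \<Rightarrow> real ^ 'k) \<Rightarrow> real ^ 'k ^ 'k" where
  "cov_matrix p X = (\<chi> a b. measure_pmf.expectation p
     (\<lambda>w. (X w $ a - measure_pmf.expectation p (\<lambda>w. X w $ a)) *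
          (X w $ b - measure_pmf.expectation p (\<lambda>w. X w $ b))))"

definition Sigma_x :: "nat \<Rightarrow> nat \<Rightarrow> real ^ 'k ^ 'n \<Rightarrow> real ^ 'k ^ 'k" where
  "Sigma_x nT nC x = cov_matrix (design nT) (xdiff nT nC x)"

definition pos_def :: "real ^ 'k ^ 'k \<Rightarrow> bool" where
  "pos_def A \<longleftrightarrow> transpose A = A \<and> (\<forall>v. v \<noteq> 0 \<longrightarrow> 0 < v \<bullet> (A *v v))"

definition ridge_mahalanobis ::
    "nat \<Rightarrow> nat \<Rightarrow> real ^ 'k ^ 'n \<Rightarrow> real \<Rightarrow> real ^ 'n \<Rightarrow> real" where
  "ridge_mahalanobis nT nC x lam W =
     xdiff nT nC x W \<bullet> (matrix_inv (Sigma_x nT nC x + lam *\<^sub>R mat 1) *v xdiff nT nC x W)"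

definition y_obs :: "real ^ 'n \<Rightarrow> real ^ 'n \<Rightarrow> real ^ 'n \<Rightarrow> 'n \<Rightarrow> real" where
  "y_obs Y1 Y0 W i = W $ i * Y1 $ i + (1 - W $ i) * Y0 $ i"

definition tau :: "real ^ 'n \<Rightarrow> real ^ 'n \<Rightarrow> real" where
  "tau Y1 Y0 = (1 / real CARD('n)) * (\<Sum>i\<in>UNIV. Y1 $ i - Y0 $ i)"

definition tau_hat :: "nat \<Rightarrow> nat \<Rightarrow> real ^ 'n \<Rightarrow> real ^ 'n \<Rightarrow> real ^ 'n \<Rightarrow> real" where
  "tau_hat nT nC Y1 Y0 W =
     (1 / real nT) * (\<Sum>i\<in>UNIV. W $ i * y_obs Y1 Y0 W i) -
     (1 / real nC) * (\<Sum>i\<in>UNIV. (1 - W $ i) * y_obs Y1 Y0 W i)"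

text \<open>
  The closed form of the covariance matrix in terms of the finite-population covariance of the rows.
\<close>

definition xbar_N :: "real ^ 'k ^ 'n \<Rightarrow> real ^ 'k" where
  "xbar_N x = (1 / real CARD('n)) *\<^sub>R (1 v* x)"

definition S2 :: "real ^ 'k ^ 'n \<Rightarrow> real ^ 'k ^ 'k" where
  "S2 x = (1 / real (CARD('n) - 1)) *\<^sub>R
     (transpose (\<chi> i. x $ i - xbar_N x) ** (\<chi> i. x $ i - xbar_N x))"

lemma assignments_finite: "finite (assignments nT :: (real ^ 'n) set)"
proof -
  have "(assignments nT :: (real ^ 'n) set) \<subseteq> vec_lambda ` (UNIV \<rightarrow>\<^sub>E {0, 1})"
  proof
    fix W :: "real ^ 'n" assume "W \<in> assignments nT"
    then have "W = vec_lambda (($) W)" "($) W \<in> UNIV \<rightarrow>\<^sub>E {0, 1}"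
      by (auto simp: assignments_def PiE_def)
    then show "W \<in> vec_lambda ` (UNIV \<rightarrow>\<^sub>E {0, 1})" by blast
  qed
  then show ?thesis
    by (rule finite_subset) (intro finite_imageI finite_PiE; simp)
qed

lemma assignments_nonempty:
  assumes "nT \<le> CARD('n)" shows "(assignments nT :: (real ^ 'n) set) \<noteq> {}"
proof -
  obtain S :: "'n set" where S: "card S = nT"
    using obtain_subset_with_card_n[OF assms] by blast
  have "(\<chi> i. if i \<in> S then 1 else 0) \<in> (assignments nT :: (real ^ 'n) set)"
    using S by (auto simp: assignments_def)
  then show ?thesis by blast
qed

lemma set_pmf_design:
  assumes "nT \<le> CARD('n)" shows "set_pmf (design nT :: (real ^ 'n) pmf) = assignments nT"
  by (simp add: design_def assignments_finite assignments_nonempty assms)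

lemma integrable_design:
  fixes f :: "real ^ 'n \<Rightarrow> real"
  assumes "nT \<le> CARD('n)"
  shows "integrable (measure_pmf (design nT)) f"
  by (rule integrable_measure_pmf_finite)
    (simp add: set_pmf_design assms assignments_finite)

lemma design_permute:
  fixes f :: "real ^ 'n \<Rightarrow> real"
  assumes le: "nT \<le> CARD('n)" and p: "bij p" and inv: "\<And>i. p (p i) = i"
  shows "measure_pmf.expectation (design nT) (\<lambda>W. f (\<chi> i. W $ p i)) =
    measure_pmf.expectation (design nT) f"
proof -
  let ?h = "\<lambda>W :: real ^ 'n. (\<chi> i. W $ p i)"
  have mem: "?h W \<in> assignments nT" if "W \<in> assignments nT" for W
  proof -
    have "{i. W $ p i = 1} = p ` {i. W $ i = 1}"
      using inv by (auto simp: image_iff) (metis inv)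
    then have "card {i. W $ p i = 1} = card {i. W $ i = 1}"
      using p by (metis bij_is_inj card_image inj_on_subset subset_UNIV)
    then show ?thesis using that by (auto simp: assignments_def)
  qed
  have "bij_betw ?h (assignments nT) (assignments nT)"
    by (rule bij_betw_byWitness[where f' = ?h]) (auto simp: inv mem)
  then have "map_pmf ?h (design nT) = design nT"
    unfolding design_def
    using map_pmf_of_set_bij_betw[OF _ assignments_nonempty[OF le] assignments_finite] by blast
  then show ?thesis by (metis integral_map_pmf)
qed

lemma design_moments:
  fixes i j :: "'n :: finite"
  assumes N: "nT + nC = CARD('n)" and nT: "nT \<ge> 1" and nC: "nC \<ge> 1"
  defines "E \<equiv> measure_pmf.expectation (design nT :: (real ^ 'n) pmf)"
  shows "E (\<lambda>W. W $ i) = real nT / CARD('n)"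
    and "i \<noteq> j \<Longrightarrow> E (\<lambda>W. W $ i * W $ j) =
      real nT * (real nT - 1) / (CARD('n) * (real CARD('n) - 1))"
proof -
  have le: "nT \<le> CARD('n)" using N by simp
  note int = integrable_design[OF le]
  have tr: "bij (Transposition.transpose a b)"
    "\<And>i. Transposition.transpose a b (Transposition.transpose a b i) = i" for a b :: 'n
    by simp_all
  have sumW: "(\<Sum>j\<in>UNIV. W $ j) = real nT" if "W \<in> assignments nT" for W :: "real ^ 'n"
  proof -
    have "(\<Sum>j\<in>UNIV. W $ j) = (\<Sum>j\<in>UNIV. if W $ j = 1 then 1 else 0)"
      using that by (intro sum.cong) (auto simp: assignments_def)
    also have "\<dots> = real (card {j. W $ j = 1})" by (simp add: sum.If_cases)
    finally show ?thesis using that by (simp add: assignments_def)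
  qed
  have E1: "E (\<lambda>W. W $ a) = E (\<lambda>W. W $ b)" for a b
    using design_permute[OF le tr, of "\<lambda>W. W $ a" a b] by (simp add: E_def)
  have E_cong: "E f = E g" if "\<And>W. W \<in> assignments nT \<Longrightarrow> f W = g W" for f g
    unfolding E_def using that
    by (intro integral_cong_AE) (auto simp: AE_measure_pmf_iff set_pmf_design[OF le])
  have "(\<Sum>j\<in>(UNIV :: 'n set). E (\<lambda>W. W $ j)) = E (\<lambda>W. \<Sum>j\<in>UNIV. W $ j)"
    by (simp add: E_def int)
  also have "\<dots> = E (\<lambda>_. real nT)" by (rule E_cong) (rule sumW)
  also have "\<dots> = real nT" by (simp add: E_def)
  finally have "(\<Sum>j\<in>(UNIV :: 'n set). E (\<lambda>W. W $ i)) = real nT"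
    using E1 by (metis (no_types, lifting) sum.cong)
  then show p: "E (\<lambda>W. W $ i) = real nT / CARD('n)"
    by (simp add: field_simps)
  show "E (\<lambda>W. W $ i * W $ j) = real nT * (real nT - 1) / (CARD('n) * (real CARD('n) - 1))"
    if ij: "i \<noteq> j"
  proof -
    have E2: "E (\<lambda>W. W $ i * W $ b) = E (\<lambda>W. W $ i * W $ j)" if "b \<noteq> i" for b
      using design_permute[OF le tr, of "\<lambda>W. W $ i * W $ b" b j] that ij by (simp add: E_def)
    have sq: "E (\<lambda>W. W $ i * W $ i) = E (\<lambda>W. W $ i)"
    proof (rule E_cong)
      fix W :: "real ^ 'n" assume "W \<in> assignments nT"
      then have "W $ i = 0 \<or> W $ i = 1" by (auto simp: assignments_def)
      then show "W $ i * W $ i = W $ i" by auto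
    qed
    have "(\<Sum>b\<in>UNIV. E (\<lambda>W. W $ i * W $ b)) = E (\<lambda>W. \<Sum>b\<in>UNIV. W $ i * W $ b)"
      by (simp add: E_def int)
    also have "\<dots> = E (\<lambda>W. W $ i * real nT)"
      by (rule E_cong) (simp add: sum_distrib_left[symmetric] sumW)
    also have "\<dots> = real nT * E (\<lambda>W. W $ i)" by (simp add: E_def)
    finally have "(\<Sum>b\<in>UNIV. E (\<lambda>W. W $ i * W $ b)) = real nT * E (\<lambda>W. W $ i)" .
    moreover have "(\<Sum>b\<in>UNIV. E (\<lambda>W. W $ i * W $ b)) =
        E (\<lambda>W. W $ i * W $ i) + (\<Sum>b\<in>UNIV - {i}. E (\<lambda>W. W $ i * W $ b))"
      by (simp add: sum.remove)
    moreover have "(\<Sum>b\<in>UNIV - {i}. E (\<lambda>W. W $ i * W $ b)) =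
        (\<Sum>b\<in>UNIV - {i}. E (\<lambda>W. W $ i * W $ j))"
      using E2 by (intro sum.cong) auto
    ultimately have "(real CARD('n) - 1) * E (\<lambda>W. W $ i * W $ j) = (real nT - 1) * (real nT / CARD('n))"
      using N nT nC by (simp add: sq p card_Diff_singleton of_nat_diff left_diff_distrib diff_divide_distrib)
    moreover have "real CARD('n) - 1 > 0" using N nT nC by linarith
    ultimately show ?thesis by (simp add: field_simps)
  qed
qed

lemma Sigma_x_eq:
  fixes x :: "real ^ 'k ^ 'n"
  assumes N: "nT + nC = CARD('n)" and nT: "nT \<ge> 1" and nC: "nC \<ge> 1"
  shows "Sigma_x nT nC x = (real CARD('n) / (real nT * real nC)) *\<^sub>R S2 x"
proof -
  have le: "nT \<le> CARD('n)" using N by simp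
  note int = integrable_design[OF le]
  define E :: "(real ^ 'n \<Rightarrow> real) \<Rightarrow> real"
    where "E = measure_pmf.expectation (design nT)"
  define n where "n = real CARD('n)"
  define t where "t = real nT"
  define u where "u = real nC"
  have ntu: "n = t + u" using N by (simp add: n_def t_def u_def of_nat_add[symmetric])
  have tu: "t \<ge> 1" "u \<ge> 1" using nT nC by (simp_all add: t_def u_def)
  define d where "d = (\<lambda>(W :: real ^ 'n) i. n / (t * u) * W $ i - 1 / u)"
  define \<delta> where "\<delta> = (\<lambda>i j :: 'n. if i = j then 1 else 0 :: real)"
  have xd: "xdiff nT nC x W $ a = (\<Sum>i\<in>UNIV. x $ i $ a * d W i)" for W a
  proof -
    have "xdiff nT nC x W $ a = (\<Sum>i\<in>UNIV. x $ i $ a * (W $ i / t - (1 - W $ i) / u))"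
      by (simp add: xdiff_def xbar_T_def xbar_C_def matrix_vector_mult_def transpose_def
          t_def u_def sum_distrib_left sum_subtractf[symmetric] diff_divide_distrib algebra_simps)
    also have "\<dots> = (\<Sum>i\<in>UNIV. x $ i $ a * d W i)"
      using tu by (intro sum.cong refl arg_cong2[where f = "(*)"])
        (simp add: d_def ntu field_simps)
    finally show ?thesis .
  qed
  have EW: "E (\<lambda>W. W $ i) = t / n" for i
    using design_moments(1)[OF N nT nC] by (simp add: E_def t_def n_def)
  have Ed: "E (\<lambda>W. d W i) = 0" for i
  proof -
    have "E (\<lambda>W. d W i) = n / (t * u) * E (\<lambda>W. W $ i) - 1 / u"
      by (simp add: E_def d_def int)
    then show ?thesis using tu by (simp add: EW ntu)
  qed
  have EWW: "E (\<lambda>W. W $ i * W $ j) = (if i = j then t / n else t * (t - 1) / (n * (n - 1)))" for i j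
  proof (cases "i = j")
    case True
    have "E (\<lambda>W. W $ i * W $ i) = E (\<lambda>W. W $ i)"
      unfolding E_def
    proof (intro integral_cong_AE)
      show "AE W in measure_pmf (design nT). W $ i * W $ i = W $ i"
        unfolding AE_measure_pmf_iff set_pmf_design[OF le]
      proof
        fix W :: "real ^ 'n" assume "W \<in> assignments nT"
        then have "W $ i = 0 \<or> W $ i = 1" by (auto simp: assignments_def)
        then show "W $ i * W $ i = W $ i" by auto
      qed
    qed simp_all
    then show ?thesis using True by (simp add: EW)
  next
    case False
    then show ?thesis
      using design_moments(2)[OF N nT nC False] by (simp add: E_def t_def n_def)
  qed
  have Edd: "E (\<lambda>W. d W i * d W j) = n / (t * u * (n - 1)) * (\<delta> i j - 1 / n)" for i j
  proof -
    have "(\<lambda>W. d W i * d W j) = (\<lambda>W. (n / (t * u))\<^sup>2 * (W $ i * W $ j)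
        - n / (t * u\<^sup>2) * W $ i - n / (t * u\<^sup>2) * W $ j + 1 / u\<^sup>2)"
      using tu by (auto simp: d_def fun_eq_iff field_simps power2_eq_square)
    then have "E (\<lambda>W. d W i * d W j) = (n / (t * u))\<^sup>2 * E (\<lambda>W. W $ i * W $ j)
        - n / (t * u\<^sup>2) * E (\<lambda>W. W $ i) - n / (t * u\<^sup>2) * E (\<lambda>W. W $ j) + 1 / u\<^sup>2"
      by (simp add: E_def int)
    also have "\<dots> = (n / (t * u))\<^sup>2 * E (\<lambda>W. W $ i * W $ j) - 1 / u\<^sup>2"
    proof -
      have "n / (t * u\<^sup>2) * (t / n) = 1 / u\<^sup>2" using tu ntu by simp
      then show ?thesis unfolding EW by simp
    qed
    also have "\<dots> = n / (t * u * (n - 1)) * (\<delta> i j - 1 / n)"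
    proof -
      have nz: "t \<noteq> 0" "u \<noteq> 0" "n \<noteq> 0" "n - 1 \<noteq> 0" "t + u - 1 \<noteq> 0" "t + u \<noteq> 0"
        using tu ntu by auto
      have A: "(n / (t * u))\<^sup>2 * (t / n) - 1 / u\<^sup>2 = n / (t * u * (n - 1)) * (1 - 1 / n)"
      proof -
        have "(n / (t * u))\<^sup>2 * (t / n) - 1 / u\<^sup>2 = (n - t) / (t * u\<^sup>2)"
          using nz by (simp add: divide_simps power2_eq_square)
        also have "\<dots> = 1 / (t * u)" using nz by (simp add: ntu power2_eq_square)
        also have "\<dots> = n / (t * u * (n - 1)) * (1 - 1 / n)"
        proof -
          have "1 - 1 / n = (n - 1) / n" using nz by (simp add: field_simps)
          then show ?thesis using nz by simp
        qed
        finally show ?thesis .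
      qed
      have B: "(n / (t * u))\<^sup>2 * (t * (t - 1) / (n * (n - 1))) - 1 / u\<^sup>2
          = n / (t * u * (n - 1)) * (0 - 1 / n)"
      proof -
        have "(n / (t * u))\<^sup>2 * (t * (t - 1) / (n * (n - 1))) - 1 / u\<^sup>2
            = n * (t - 1) / (t * u\<^sup>2 * (n - 1)) - 1 / u\<^sup>2"
          using nz by (simp add: power2_eq_square)
        also have "\<dots> = (n * (t - 1) - t * (n - 1)) / (t * u\<^sup>2 * (n - 1))"
          using nz by (simp add: diff_divide_distrib)
        also have "n * (t - 1) - t * (n - 1) = - u" by (simp add: ntu algebra_simps)
        also have "- u / (t * u\<^sup>2 * (n - 1)) = n / (t * u * (n - 1)) * (0 - 1 / n)"
          using nz by (simp add: power2_eq_square)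
        finally show ?thesis .
      qed
      show ?thesis using A B by (simp add: EWW \<delta>_def)
    qed
    finally show ?thesis .
  qed
  have "Sigma_x nT nC x $ a $ b = ((n / (t * u)) *\<^sub>R S2 x) $ a $ b" for a b
  proof -
    define k where "k = n / (t * u * (n - 1))"
    define s where "s = (\<lambda>a. \<Sum>i\<in>UNIV. x $ i $ a)"
    have E0: "E (\<lambda>W. xdiff nT nC x W $ a) = 0" for a
    proof -
      have "E (\<lambda>W. xdiff nT nC x W $ a) = (\<Sum>i\<in>UNIV. x $ i $ a * E (\<lambda>W. d W i))"
        by (simp add: xd E_def int)
      then show ?thesis by (simp add: Ed)
    qed
    have "Sigma_x nT nC x $ a $ b = E (\<lambda>W. xdiff nT nC x W $ a * xdiff nT nC x W $ b)"
      using E0 by (simp add: Sigma_x_def cov_matrix_def E_def)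
    also have "\<dots> = E (\<lambda>W. \<Sum>i\<in>UNIV. \<Sum>j\<in>UNIV. x $ i $ a * x $ j $ b * (d W i * d W j))"
      by (simp add: xd sum_product mult.assoc mult.left_commute)
    also have "\<dots> = (\<Sum>i\<in>UNIV. \<Sum>j\<in>UNIV. x $ i $ a * x $ j $ b * E (\<lambda>W. d W i * d W j))"
      by (simp add: E_def int)
    also have "\<dots> = (\<Sum>i\<in>UNIV. \<Sum>j\<in>UNIV. k * (x $ i $ a * x $ j $ b * \<delta> i j)
        - k / n * (x $ i $ a * x $ j $ b))"
      unfolding Edd k_def[symmetric] by (intro sum.cong refl) (simp add: algebra_simps)
    also have "\<dots> = k * (\<Sum>i\<in>UNIV. \<Sum>j\<in>UNIV. x $ i $ a * x $ j $ b * \<delta> i j) - k / n * (s a * s b)"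
      unfolding s_def sum_product by (simp only: sum_subtractf sum_distrib_left)
    also have "(\<Sum>i\<in>UNIV. \<Sum>j\<in>UNIV. x $ i $ a * x $ j $ b * \<delta> i j) = (\<Sum>i\<in>UNIV. x $ i $ a * x $ i $ b)"
      by (intro sum.cong refl) (simp add: \<delta>_def if_distrib cong: if_cong)
    finally have L: "Sigma_x nT nC x $ a $ b =
      k * (\<Sum>i\<in>UNIV. x $ i $ a * x $ i $ b) - k / n * (s a * s b)" .
    have m: "xbar_N x $ a = s a / n" for a
      by (simp add: xbar_N_def vector_matrix_mult_def s_def n_def)
    have "S2 x $ a $ b = 1 / (n - 1) * (\<Sum>i\<in>UNIV. (x $ i $ a - s a / n) * (x $ i $ b - s b / n))"
      by (simp add: S2_def matrix_matrix_mult_def transpose_def m n_def of_nat_diff)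
    also have "(\<Sum>i\<in>UNIV. (x $ i $ a - s a / n) * (x $ i $ b - s b / n)) =
      (\<Sum>i\<in>UNIV. x $ i $ a * x $ i $ b - x $ i $ a * (s b / n) - s a / n * x $ i $ b + s a / n * (s b / n))"
      by (simp add: algebra_simps)
    also have "\<dots> = (\<Sum>i\<in>UNIV. x $ i $ a * x $ i $ b) - s a * (s b / n) - s a / n * s b
        + n * (s a / n * (s b / n))"
      by (simp only: sum.distrib sum_subtractf sum_distrib_left[symmetric]
          sum_distrib_right[symmetric] s_def[symmetric]) (simp add: n_def s_def)
    also have "\<dots> = (\<Sum>i\<in>UNIV. x $ i $ a * x $ i $ b) - s a * s b / n"
      using tu ntu by simp
    finally have R: "S2 x $ a $ b = 1 / (n - 1) * ((\<Sum>i\<in>UNIV. x $ i $ a * x $ i $ b) - s a * s b / n)" .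
    show ?thesis unfolding L by (simp add: R k_def right_diff_distrib)
  qed
  then show ?thesis by (simp add: vec_eq_iff n_def t_def u_def)
qed

end

theory Submission
  imports Defs
begin

text \<open>
  With groups of equal size, exchanging treatment and control, \<open>W \<mapsto> 1 - W\<close>, preserves the uniform
  distribution on the assignments and reverses the sign of the difference in covariate means. The
  ridge Mahalanobis distance is an even function of that difference, so the acceptance region is
  also preserved and the conditional distribution is invariant under the exchange. Averaging over
  the exchange turns the difference in means into \<open>0\<close> and \<open>\<tau>\<close>-hat into \<open>\<tau>\<close>, pointwise.
\<close>

text \<open>Conditioning rescales the constant mass on \<open>A\<close> by a constant, so the result
  is again uniform. This turns invariance of the conditional law into closure of a finite set under
  the exchange.\<close>

lemma cond_pmf_of_set:
  assumes fin: "finite A" and ne: "A \<inter> S \<noteq> {}"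
  shows "cond_pmf (pmf_of_set A) S = pmf_of_set (A \<inter> S)"
proof -
  have "A \<noteq> {}" "card A > 0" using fin ne by (auto simp: card_gt_0_iff)
  moreover have "set_pmf (pmf_of_set A) \<inter> S \<noteq> {}" using calculation fin ne by simp
  ultimately show ?thesis
    using fin ne by (intro pmf_eqI)
      (auto simp: pmf_cond measure_pmf_of_set pmf_of_set indicator_def)
qed

lemma map_pmf_of_set_involution:
  assumes "finite A" and "A \<noteq> {}"
    and "\<And>w. w \<in> A \<Longrightarrow> h w \<in> A" and "\<And>w. w \<in> A \<Longrightarrow> h (h w) = w"
  shows "map_pmf h (pmf_of_set A) = pmf_of_set A"
  using assms
  by (intro map_pmf_of_set_bij_betw bij_betw_byWitness[where f' = h]) auto

text \<open>Invariance gives \<open>f\<close> and \<open>f\<close> after \<open>h\<close> the same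
  mean, so twice that mean is the mean of the constant \<open>2 *\<^sub>R c\<close>; finite support
  supplies integrability. The Banach-valued form covers both the covariate vector and the real
  estimator.\<close>

lemma expectation_invariant_average:
  fixes f :: "'a \<Rightarrow> 'b :: {banach, second_countable_topology}"
  assumes inv: "map_pmf h p = p" and fin: "finite (set_pmf p)"
    and avg: "\<And>w. w \<in> set_pmf p \<Longrightarrow> f w + f (h w) = 2 *\<^sub>R c"
  shows "measure_pmf.expectation p f = c"
proof -
  have "measure_pmf.expectation p (\<lambda>w. f (h w)) = measure_pmf.expectation p f"
    using inv by (metis integral_map_pmf)
  moreover have "measure_pmf.expectation p (\<lambda>w. f w + f (h w)) = measure_pmf.expectation p (\<lambda>_. 2 *\<^sub>R c)"
    by (intro integral_cong_AE) (auto simp: AE_measure_pmf_iff avg)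
  ultimately have "2 *\<^sub>R measure_pmf.expectation p f = 2 *\<^sub>R c"
    by (simp add: integrable_measure_pmf_finite fin scaleR_2)
  then show ?thesis by simp
qed

lemma assignments_complement:
  fixes W :: "real ^ 'n"
  assumes W: "W \<in> assignments nT" and N: "nT + nC = CARD('n)"
  shows "1 - W \<in> assignments nC"
proof -
  have "{i. (1 - W) $ i = 1} = UNIV - {i. W $ i = 1}"
    using W by (auto simp: assignments_def)
  then have "card {i. (1 - W) $ i = 1} = CARD('n) - nT"
    using W by (simp add: card_Diff_subset assignments_def)
  then show ?thesis
    using W N by (auto simp: assignments_def)
qed

text \<open>With the same weight \<open>1 / n\<close> in both groups, the exchange swaps the two
  means exactly.\<close>

lemma xdiff_complement: "xdiff n n x (1 - W) = - xdiff n n x W"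
  by (simp add: xdiff_def xbar_T_def xbar_C_def)

lemma ridge_mahalanobis_complement:
  "ridge_mahalanobis n n x lam (1 - W) = ridge_mahalanobis n n x lam W"
  by (simp add: ridge_mahalanobis_def xdiff_complement linear_neg[OF matrix_vector_mul_linear])

text \<open>Each unit reveals \<open>Y1\<close> under one of the two assignments and
  \<open>Y0\<close> under the other, always with weight \<open>1 / n\<close>, so every unit effect
  appears exactly once.\<close>

lemma tau_hat_complement:
  fixes W Y1 Y0 :: "real ^ 'n"
  assumes W: "W \<in> assignments m" and N: "n + n = CARD('n)"
  shows "tau_hat n n Y1 Y0 W + tau_hat n n Y1 Y0 (1 - W) = 2 * tau Y1 Y0"
proof -
  have "tau_hat n n Y1 Y0 W + tau_hat n n Y1 Y0 (1 - W) = (1 / real n) *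
      (\<Sum>i\<in>UNIV. W $ i * y_obs Y1 Y0 W i - (1 - W $ i) * y_obs Y1 Y0 W i
        + ((1 - W) $ i * y_obs Y1 Y0 (1 - W) i - (1 - (1 - W) $ i) * y_obs Y1 Y0 (1 - W) i))"
    unfolding tau_hat_def sum.distrib sum_subtractf by (simp add: algebra_simps)
  also have "\<dots> = (1 / real n) * (\<Sum>i\<in>UNIV. Y1 $ i - Y0 $ i)"
  proof (intro arg_cong2[where f = "(*)"] sum.cong refl)
    fix i
    have "W $ i = 0 \<or> W $ i = 1" using W by (auto simp: assignments_def)
    then show "W $ i * y_obs Y1 Y0 W i - (1 - W $ i) * y_obs Y1 Y0 W i
        + ((1 - W) $ i * y_obs Y1 Y0 (1 - W) i - (1 - (1 - W) $ i) * y_obs Y1 Y0 (1 - W) i)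
        = Y1 $ i - Y0 $ i"
      by (auto simp: y_obs_def)
  qed
  \<comment> \<open>The population has size \<open>n + n\<close>, so \<open>1 / n\<close> is twice
    the weight used in \<open>tau\<close>.\<close>
  also have "\<dots> = 2 * tau Y1 Y0"
    by (simp add: tau_def N[symmetric])
  finally show ?thesis .
qed

theorem theorem4p1:
  fixes x :: "real ^ 'k ^ 'n"
    and Y1 Y0 :: "real ^ 'n"
    and nT nC :: nat
    and lam a :: real
  assumes "nT \<ge> 1" and "nC \<ge> 1" and "nT + nC = CARD('n)"
    and "pos_def (Sigma_x nT nC x)"
    and "lam \<ge> 0" and "a \<ge> 0"
    and "measure_pmf.prob (design nT) {W. ridge_mahalanobis nT nC x lam W \<le> a} > 0"
    and "nT = nC"
  shows "measure_pmf.expectation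
           (cond_pmf (design nT) {W. ridge_mahalanobis nT nC x lam W \<le> a}) (xdiff nT nC x) = 0
       \<and> measure_pmf.expectation
           (cond_pmf (design nT) {W. ridge_mahalanobis nT nC x lam W \<le> a})
           (tau_hat nT nC Y1 Y0) = tau Y1 Y0"
proof -
  have N: "nC + nC = CARD('n)" using assms(3,8) by simp
  then have le: "nC \<le> CARD('n)" by simp
  define S where "S = {W :: real ^ 'n. ridge_mahalanobis nC nC x lam W \<le> a}"
  define B where "B = (assignments nC :: (real ^ 'n) set) \<inter> S"
  have fin: "finite B" by (simp add: B_def assignments_finite)
  \<comment> \<open>Positive acceptance probability yields an accepted assignment, so that
    conditioning on \<open>S\<close> and the uniform law on \<open>B\<close> are meaningful.\<close>
  have "measure_pmf.prob (design nC) S \<noteq> 0"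
    using assms(7,8) by (simp add: S_def)
  then have ne: "B \<noteq> {}"
    by (simp add: measure_pmf_zero_iff set_pmf_design[OF le] B_def)
  have q: "cond_pmf (design nC) S = pmf_of_set B"
    unfolding design_def B_def using ne
    by (intro cond_pmf_of_set) (simp_all add: B_def assignments_finite)
  have mem: "1 - W \<in> B" if "W \<in> B" for W
    using that assignments_complement[OF _ N]
    by (auto simp: B_def S_def ridge_mahalanobis_complement)
  have inv: "map_pmf (\<lambda>W. 1 - W) (pmf_of_set B) = pmf_of_set B"
    using fin ne mem by (intro map_pmf_of_set_involution) simp_all
  have supp: "set_pmf (pmf_of_set B) = B" "finite (set_pmf (pmf_of_set B))"
    using fin ne by simp_all
  have "measure_pmf.expectation (pmf_of_set B) (xdiff nC nC x) = 0"
    by (rule expectation_invariant_average[OF inv supp(2)]) (simp add: xdiff_complement)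
  moreover have "measure_pmf.expectation (pmf_of_set B) (tau_hat nC nC Y1 Y0) = tau Y1 Y0"
  proof (rule expectation_invariant_average[OF inv supp(2)])
    fix W assume "W \<in> set_pmf (pmf_of_set B)"
    then have "W \<in> assignments nC" unfolding supp(1) by (simp add: B_def)
    then show "tau_hat nC nC Y1 Y0 W + tau_hat nC nC Y1 Y0 (1 - W) = 2 *\<^sub>R tau Y1 Y0"
      using tau_hat_complement[OF _ N] by simp
  qed
  ultimately show ?thesis
    using assms(8) q by (simp add: S_def)
qed

end
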